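(* Let $E$ be a complex Banach space. Then the composition mapping $$(f,g)\in\mathcal{H}_b(E,E)\times\mathcal{H}_b(E,E)\mapsto f\circ g\in\mathcal{H}_b(E,E)$$ is holomorphic.
   Context: $\mathcal{H}_b(E,E)$ is the space of holomorphic (complex Fréchet differentiable) mappings $f:E\to E$ that are bounded on every bounded subset of $E$, with the topology $\tau_b$ of uniform convergence on bounded subsets of $E$; it is a Fréchet space. A mapping between complex Fréchet spaces is holomorphic if it is continuous and G-holomorphic, i.e. for all points $a$ and directions $b$ the mapping $\lambda\mapsto F(a+\lambda b)$ is analytic in $\lambda\in\mathbb{C}$. *)

theory Defs
  imports "HOL-Analysis.Analysis"
begin

class scaleC =
  fixes scaleC :: "complex \<Rightarrow> 'a \<Rightarrow> 'a"  (infixr \<open>*\<^sub>C\<close> 75)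

class complex_vector = scaleC + ab_group_add +
  assumes scaleC_add_right: "c *\<^sub>C (x + y) = c *\<^sub>C x + c *\<^sub>C y"
    and scaleC_add_left: "(c + d) *\<^sub>C x = c *\<^sub>C x + d *\<^sub>C x"
    and scaleC_scaleC: "c *\<^sub>C d *\<^sub>C x = (c * d) *\<^sub>C x"
    and scaleC_one: "1 *\<^sub>C x = x"

class complex_normed_vector = complex_vector + real_normed_vector +
  assumes scaleR_scaleC: "r *\<^sub>R x = complex_of_real r *\<^sub>C x"
    and norm_scaleC: "norm (c *\<^sub>C x) = cmod c * norm x"

class complex_banach = complex_normed_vector + banach

instantiation complex :: complex_banach
begin
definition scaleC_complex :: "complex \<Rightarrow> complex \<Rightarrow> complex"
  where "scaleC_complex c x = c * x"
instance
  by standard (auto simp: scaleC_complex_def algebra_simps norm_mult scaleR_conv_of_real)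
end

instantiation prod :: (complex_vector, complex_vector) complex_vector
begin
definition scaleC_prod :: "complex \<Rightarrow> 'a \<times> 'b \<Rightarrow> 'a \<times> 'b"
  where "scaleC_prod c p = (c *\<^sub>C fst p, c *\<^sub>C snd p)"
instance
  by standard (auto simp: scaleC_prod_def scaleC_add_right scaleC_add_left scaleC_scaleC scaleC_one)
end

text \<open>The real Frechet derivative \<open>D\<close> in \<open>has_derivative\<close> is bounded and
  real linear, so complex homogeneity makes it a bounded complex linear map.\<close>

definition complex_frechet_differentiable ::
    "('a::complex_normed_vector \<Rightarrow> 'b::complex_normed_vector) \<Rightarrow> 'a \<Rightarrow> bool"
  where "complex_frechet_differentiable f x \<longleftrightarrow>
    (\<exists>D. (f has_derivative D) (at x) \<and> (\<forall>c v. D (c *\<^sub>C v) = c *\<^sub>C D v))"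

definition holomorphic_bounded_type ::
    "('a::complex_normed_vector \<Rightarrow> 'b::complex_normed_vector) \<Rightarrow> bool"
  where "holomorphic_bounded_type f \<longleftrightarrow>
    (\<forall>x. complex_frechet_differentiable f x) \<and> (\<forall>B. bounded B \<longrightarrow> bounded (f ` B))"

lemma bounded_linear_scaleC: "bounded_linear (\<lambda>x::'a::complex_normed_vector. c *\<^sub>C x)"
  by (rule bounded_linear_intro[where K = "cmod c"])
    (auto simp: scaleC_add_right scaleR_scaleC scaleC_scaleC norm_scaleC mult.commute)

lemma scaleC_zero_right: "c *\<^sub>C (0::'a::complex_vector) = 0"
  using scaleC_add_right[of c 0 "0::'a"] by simp

lemma scaleC_minus_right: "c *\<^sub>C (- x) = - (c *\<^sub>C (x::'a::complex_vector))"
  using scaleC_add_right[of c x "- x"] by (simp add: scaleC_zero_right minus_unique)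

lemma holomorphic_bounded_type_zero: "holomorphic_bounded_type (\<lambda>_. 0)"
proof -
  have "complex_frechet_differentiable (\<lambda>_. 0 :: 'b) (x :: 'a)" for x
    unfolding complex_frechet_differentiable_def
    by (rule exI[of _ "\<lambda>_. 0"]) (auto simp: scaleC_zero_right)
  moreover have "bounded ((\<lambda>_. 0 :: 'b) ` B)" for B :: "'a set"
    by (rule bounded_subset[of "{0}"]) auto
  ultimately show ?thesis
    unfolding holomorphic_bounded_type_def by blast
qed

lemma holomorphic_bounded_type_add:
  assumes "holomorphic_bounded_type f" "holomorphic_bounded_type g"
  shows "holomorphic_bounded_type (\<lambda>x. f x + g x)"
proof -
  have "complex_frechet_differentiable (\<lambda>x. f x + g x) x" for x
  proof -
    obtain D D' where D: "(f has_derivative D) (at x)" "\<forall>c v. D (c *\<^sub>C v) = c *\<^sub>C D v"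
      and D': "(g has_derivative D') (at x)" "\<forall>c v. D' (c *\<^sub>C v) = c *\<^sub>C D' v"
      using assms unfolding holomorphic_bounded_type_def complex_frechet_differentiable_def by metis
    show ?thesis unfolding complex_frechet_differentiable_def
      by (rule exI[of _ "\<lambda>v. D v + D' v"])
        (use D D' in \<open>auto intro: has_derivative_add simp: scaleC_add_right\<close>)
  qed
  moreover have "bounded ((\<lambda>x. f x + g x) ` B)" if "bounded B" for B
    using assms that unfolding holomorphic_bounded_type_def by (intro bounded_plus_comp) blast+
  ultimately show ?thesis unfolding holomorphic_bounded_type_def by blast
qed

lemma holomorphic_bounded_type_compose:
  assumes f: "holomorphic_bounded_type f" and g: "holomorphic_bounded_type g"
  shows "holomorphic_bounded_type (\<lambda>x. f (g x))"
proof -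
  have "complex_frechet_differentiable (\<lambda>x. f (g x)) x" for x
  proof -
    obtain D' where D': "(g has_derivative D') (at x)" "\<forall>c v. D' (c *\<^sub>C v) = c *\<^sub>C D' v"
      using g unfolding holomorphic_bounded_type_def complex_frechet_differentiable_def by metis
    obtain D where D: "(f has_derivative D) (at (g x))" "\<forall>c v. D (c *\<^sub>C v) = c *\<^sub>C D v"
      using f unfolding holomorphic_bounded_type_def complex_frechet_differentiable_def by metis
    show ?thesis unfolding complex_frechet_differentiable_def
      by (rule exI[of _ "\<lambda>v. D (D' v)"])
        (use D D' has_derivative_compose[OF D'(1) D(1)] in auto)
  qed
  moreover have "bounded ((\<lambda>x. f (g x)) ` B)" if "bounded B" for B
  proof -
    have "bounded (f ` (g ` B))"
      using f g that unfolding holomorphic_bounded_type_def by blast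
    then show ?thesis by (simp add: image_image)
  qed
  ultimately show ?thesis unfolding holomorphic_bounded_type_def by blast
qed

lemma holomorphic_bounded_type_scaleC:
  assumes "holomorphic_bounded_type f"
  shows "holomorphic_bounded_type (\<lambda>x. c *\<^sub>C f x)"
proof -
  have "complex_frechet_differentiable (\<lambda>x. c *\<^sub>C f x) x" for x
  proof -
    obtain D where D: "(f has_derivative D) (at x)" "\<forall>c v. D (c *\<^sub>C v) = c *\<^sub>C D v"
      using assms unfolding holomorphic_bounded_type_def complex_frechet_differentiable_def by metis
    show ?thesis unfolding complex_frechet_differentiable_def
      by (rule exI[of _ "\<lambda>v. c *\<^sub>C D v"])
        (use D bounded_linear.has_derivative[OF bounded_linear_scaleC D(1)] in
          \<open>auto simp: scaleC_scaleC mult.commute\<close>)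
  qed
  moreover have "bounded ((\<lambda>x. c *\<^sub>C f x) ` B)" if "bounded B" for B
  proof -
    have "bounded ((\<lambda>y. c *\<^sub>C y) ` (f ` B))"
      using assms that unfolding holomorphic_bounded_type_def
      by (intro bounded_linear_image[OF _ bounded_linear_scaleC]) blast
    then show ?thesis by (simp add: image_image)
  qed
  ultimately show ?thesis unfolding holomorphic_bounded_type_def by blast
qed

lemma scaleC_minus_one: "(- 1) *\<^sub>C x = - (x::'a::complex_vector)"
proof -
  have "0 *\<^sub>C x = 0" using scaleC_add_left[of 0 0 x] by simp
  then have "(- 1) *\<^sub>C x + x = 0"
    using scaleC_add_left[of "- 1" 1 x] by (simp add: scaleC_one)
  then show ?thesis by (simp add: eq_neg_iff_add_eq_0)
qed

lemma holomorphic_bounded_type_uminus: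
  "holomorphic_bounded_type f \<Longrightarrow> holomorphic_bounded_type (\<lambda>x. - f x)"
  using holomorphic_bounded_type_scaleC[of f "- 1"] by (simp add: scaleC_minus_one)

text \<open>The space \<open>H\<^sub>b(E, F)\<close>.\<close>

typedef (overloaded) ('a, 'b) Hb =
    "{f :: 'a::complex_normed_vector \<Rightarrow> 'b::complex_normed_vector. holomorphic_bounded_type f}"
  morphisms Hb_apply Abs_Hb
  using holomorphic_bounded_type_zero by blast

setup_lifting type_definition_Hb

lift_definition Hb_compose ::
    "('b::complex_normed_vector, 'c::complex_normed_vector) Hb \<Rightarrow>
     ('a::complex_normed_vector, 'b) Hb \<Rightarrow> ('a, 'c) Hb"
  is "\<lambda>f g. f \<circ> g"
  using holomorphic_bounded_type_compose by (simp add: comp_def)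

instantiation Hb :: (complex_normed_vector, complex_normed_vector) complex_vector
begin
lift_definition zero_Hb :: "('a, 'b) Hb" is "\<lambda>_. 0"
  by (rule holomorphic_bounded_type_zero)
lift_definition plus_Hb :: "('a, 'b) Hb \<Rightarrow> ('a, 'b) Hb \<Rightarrow> ('a, 'b) Hb"
  is "\<lambda>f g x. f x + g x"
  by (rule holomorphic_bounded_type_add)
lift_definition uminus_Hb :: "('a, 'b) Hb \<Rightarrow> ('a, 'b) Hb" is "\<lambda>f x. - f x"
  by (rule holomorphic_bounded_type_uminus)
lift_definition minus_Hb :: "('a, 'b) Hb \<Rightarrow> ('a, 'b) Hb \<Rightarrow> ('a, 'b) Hb"
  is "\<lambda>f g x. f x - g x"
  using holomorphic_bounded_type_add[OF _ holomorphic_bounded_type_uminus] by fastforce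
lift_definition scaleC_Hb :: "complex \<Rightarrow> ('a, 'b) Hb \<Rightarrow> ('a, 'b) Hb"
  is "\<lambda>c f x. c *\<^sub>C f x"
  by (rule holomorphic_bounded_type_scaleC)
instance
  by standard
    (transfer; simp add: fun_eq_iff algebra_simps scaleC_add_right scaleC_add_left
      scaleC_scaleC scaleC_one)+
end

text \<open>The topology of uniform convergence on bounded sets; see \<open>tendsto_Hb_iff\<close> below.\<close>

instantiation Hb :: (complex_normed_vector, complex_normed_vector) topological_space
begin
definition open_Hb :: "('a, 'b) Hb set \<Rightarrow> bool"
  where "open_Hb U \<longleftrightarrow> (\<forall>f\<in>U. \<exists>B e. bounded B \<and> e > 0 \<and>
    (\<forall>g. (\<forall>x\<in>B. norm (Hb_apply g x - Hb_apply f x) < e) \<longrightarrow> g \<in> U))"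
instance
proof
  show "open (UNIV :: ('a, 'b) Hb set)"
    unfolding open_Hb_def using bounded_empty zero_less_one by blast
next
  fix S T :: "('a, 'b) Hb set"
  assume S: "open S" and T: "open T"
  show "open (S \<inter> T)"
    unfolding open_Hb_def
  proof
    fix f assume f: "f \<in> S \<inter> T"
    obtain B e where B: "bounded B" "e > 0"
      "\<forall>g. (\<forall>x\<in>B. norm (Hb_apply g x - Hb_apply f x) < e) \<longrightarrow> g \<in> S"
      using S f unfolding open_Hb_def by blast
    obtain B' e' where B': "bounded B'" "e' > 0"
      "\<forall>g. (\<forall>x\<in>B'. norm (Hb_apply g x - Hb_apply f x) < e') \<longrightarrow> g \<in> T"
      using T f unfolding open_Hb_def by blast
    show "\<exists>B e. bounded B \<and> e > 0 \<and>
        (\<forall>g. (\<forall>x\<in>B. norm (Hb_apply g x - Hb_apply f x) < e) \<longrightarrow> g \<in> S \<inter> T)"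
      by (rule exI[of _ "B \<union> B'"], rule exI[of _ "min e e'"]) (use B B' in auto)
  qed
next
  fix K :: "('a, 'b) Hb set set"
  assume "\<forall>S\<in>K. open S"
  then show "open (\<Union>K)"
    unfolding open_Hb_def by (meson Union_iff)
qed
end

lemma tendsto_Hb_iff:
  fixes f :: "'i \<Rightarrow> ('a::complex_normed_vector, 'b::complex_normed_vector) Hb"
  shows "(f \<longlongrightarrow> l) F \<longleftrightarrow>
    (\<forall>B. bounded B \<longrightarrow> uniform_limit B (\<lambda>i. Hb_apply (f i)) (Hb_apply l) F)"
proof
  assume L: "(f \<longlongrightarrow> l) F"
  show "\<forall>B. bounded B \<longrightarrow> uniform_limit B (\<lambda>i. Hb_apply (f i)) (Hb_apply l) F"
  proof (intro allI impI uniform_limitI)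
    fix B :: "'a set" and e :: real
    assume B: "bounded B" and e: "0 < e"
    define U where "U = {g :: ('a, 'b) Hb.
      \<exists>d. 0 < d \<and> d < e \<and> (\<forall>x\<in>B. norm (Hb_apply g x - Hb_apply l x) \<le> d)}"
    have "open U"
      unfolding open_Hb_def
    proof
      fix g assume "g \<in> U"
      then obtain d where d: "0 < d" "d < e"
        "\<And>x. x \<in> B \<Longrightarrow> norm (Hb_apply g x - Hb_apply l x) \<le> d"
        unfolding U_def by blast
      have "h \<in> U" if h: "\<forall>x\<in>B. norm (Hb_apply h x - Hb_apply g x) < (e - d) / 2" for h
      proof -
        have "norm (Hb_apply h x - Hb_apply l x) \<le> (e + d) / 2" if "x \<in> B" for x
        proof -
          have "norm (Hb_apply h x - Hb_apply l x)
              \<le> norm (Hb_apply h x - Hb_apply g x) + norm (Hb_apply g x - Hb_apply l x)"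
            by (metis norm_triangle_ineq diff_add_cancel add_diff_eq)
          also have "\<dots> \<le> (e - d) / 2 + d"
            using h d(3) that by (intro add_mono) (auto simp: less_imp_le)
          finally show ?thesis by (simp add: field_simps)
        qed
        then show ?thesis
          unfolding U_def using d by (intro CollectI exI[of _ "(e + d) / 2"]) auto
      qed
      then show "\<exists>B e. bounded B \<and> e > 0 \<and>
          (\<forall>h. (\<forall>x\<in>B. norm (Hb_apply h x - Hb_apply g x) < e) \<longrightarrow> h \<in> U)"
        using B d(2) by (intro exI[of _ B] exI[of _ "(e - d) / 2"]) auto
    qed
    moreover have "l \<in> U"
      unfolding U_def using e by (intro CollectI exI[of _ "e / 2"]) auto
    ultimately have "eventually (\<lambda>i. f i \<in> U) F"
      using topological_tendstoD[OF L] by blast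
    then show "eventually (\<lambda>i. \<forall>x\<in>B. dist (Hb_apply (f i) x) (Hb_apply l x) < e) F"
      by eventually_elim (auto simp: U_def dist_norm intro: le_less_trans)
  qed
next
  assume R: "\<forall>B. bounded B \<longrightarrow> uniform_limit B (\<lambda>i. Hb_apply (f i)) (Hb_apply l) F"
  show "(f \<longlongrightarrow> l) F"
  proof (rule topological_tendstoI)
    fix U assume "open U" "l \<in> U"
    then obtain B e where B: "bounded B" "e > 0"
      "\<forall>g. (\<forall>x\<in>B. norm (Hb_apply g x - Hb_apply l x) < e) \<longrightarrow> g \<in> U"
      unfolding open_Hb_def by blast
    have "eventually (\<lambda>i. \<forall>x\<in>B. dist (Hb_apply (f i) x) (Hb_apply l x) < e) F"
      using R B uniform_limitD by blast
    then show "eventually (\<lambda>i. f i \<in> U) F"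
      by eventually_elim (use B(3) in \<open>auto simp: dist_norm\<close>)
  qed
qed

text \<open>Analyticity of a vector-valued function on the complex plane: around every point it is
  the sum of a power series converging in the topology of the target space.\<close>

definition entire_analytic :: "(complex \<Rightarrow> 'b::{complex_vector, topological_space}) \<Rightarrow> bool"
  where "entire_analytic \<phi> \<longleftrightarrow> (\<forall>z0. \<exists>r>0. \<exists>c :: nat \<Rightarrow> 'b. \<forall>z.
    cmod (z - z0) < r \<longrightarrow> (\<lambda>n. (z - z0) ^ n *\<^sub>C c n) sums \<phi> z)"

definition G_holomorphic ::
    "('a::complex_vector \<Rightarrow> 'b::{complex_vector, topological_space}) \<Rightarrow> bool"
  where "G_holomorphic F \<longleftrightarrow> (\<forall>a b. entire_analytic (\<lambda>z. F (a + z *\<^sub>C b)))"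

text \<open>Holomorphy of maps between complex Frechet spaces; only the vector space structures and
  the topologies enter the definition.\<close>

definition frechet_holomorphic ::
    "('a::{complex_vector, topological_space} \<Rightarrow> 'b::{complex_vector, topological_space}) \<Rightarrow> bool"
  where "frechet_holomorphic F \<longleftrightarrow> continuous_on UNIV F \<and> G_holomorphic F"

end

(* Hahn-Banach functionals of norm at most 1 reduce norm estimates for Banach-valued holomorphic
   functions to scalar ones. In this way a weakly holomorphic, locally bounded map from the
   complex plane into H_b has Taylor coefficients in H_b, by completeness of H_b, and Cauchy's
   inequalities make its Taylor series converge uniformly on bounded sets. Applied to
   w |-> (f + w h) o (g + w k), this is G-holomorphy. Continuity holds because a holomorphic map
   of bounded type is Lipschitz on bounded sets, again by Cauchy's inequalities. *)

theory Submission
  imports Defs "HOL-Complex_Analysis.Cauchy_Integral_Formula"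
begin

text \<open>Composition is not linear in \<open>g\<close>, so the expansion along a complex line is
  a genuine infinite series, and it has to converge in a topology given by suprema over bounded
  sets. One-variable theory yields a scalar Taylor series for each functional and each point
  separately; the difficulty is to find elements of H_b behind the scalar coefficients. This works
  because every scalar estimate has a constant depending only on a bound for the values and on
  radii, never on the functional or the point. Limits in H_b must again be Frechet differentiable:
  uniform convergence controls derivatives only because Cauchy's inequality bounds the derivative of
  a difference by that difference on a larger ball.\<close>

section \<open>Sublinear functionals and the Hahn-Banach theorem\<close>

definition sublinear :: "('a::real_vector \<Rightarrow> real) \<Rightarrow> bool" where
  "sublinear p \<longleftrightarrow> (\<forall>x y. p (x + y) \<le> p x + p y) \<and> (\<forall>t\<ge>0. \<forall>x. p (t *\<^sub>R x) = t * p x)"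

lemma sublinear_add: "sublinear p \<Longrightarrow> p (x + y) \<le> p x + p y"
  and sublinear_scaleR: "sublinear p \<Longrightarrow> t \<ge> 0 \<Longrightarrow> p (t *\<^sub>R x) = t * p x"
  by (auto simp: sublinear_def)

lemma sublinear_zero: "sublinear p \<Longrightarrow> p 0 = 0"
  using sublinear_scaleR[of p 0 0] by simp

lemma sublinear_ge: "sublinear p \<Longrightarrow> - p (- x) \<le> p x"
  using sublinear_add[of p x "- x"] sublinear_zero[of p] by simp

text \<open>For positive \<open>t\<close> the reverse homogeneity inequality follows by applying the
  given one to \<open>t *\<^sub>R x\<close> with factor \<open>1 / t\<close>.\<close>

lemma sublinearI:
  assumes add: "\<And>x y. p (x + y) \<le> p x + p y"
    and le: "\<And>t x. t > 0 \<Longrightarrow> p (t *\<^sub>R x) \<le> t * p x" and zero: "p 0 = 0"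
  shows "sublinear p"
  unfolding sublinear_def
proof (intro conjI allI impI)
  fix t :: real and x assume "t \<ge> 0"
  show "p (t *\<^sub>R x) = t * p x"
  proof (cases "t = 0")
    case False
    with \<open>t \<ge> 0\<close> have t: "t > 0" by simp
    have "p ((1 / t) *\<^sub>R (t *\<^sub>R x)) \<le> (1 / t) * p (t *\<^sub>R x)"
      by (rule le) (use t in simp)
    then have "t * p x \<le> p (t *\<^sub>R x)"
      using t by (simp add: field_simps)
    with le[OF t, of x] show ?thesis by simp
  qed (simp add: zero)
qed (rule add)

text \<open>The witness is an infimum over \<open>t \<ge> 0\<close>; \<open>t = 0\<close> and
  \<open>t = 1\<close> give the two upper bounds. The second one reverses subadditivity at
  \<open>y\<close>: it makes a minimal functional additive, and for \<open>p = norm\<close> it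
  forces a linear functional below \<open>q\<close> to attain the norm of \<open>y\<close>.\<close>

lemma sublinear_shift:
  fixes p :: "'a::real_vector \<Rightarrow> real" and y :: 'a
  assumes p: "sublinear p"
  obtains q where "sublinear q" "\<And>x. q x \<le> p x" "\<And>x. q x \<le> p (x + y) - p y"
proof -
  define q where "q x = (INF t\<in>{0..}. p (x + t *\<^sub>R y) - t * p y)" for x
  have bdd: "bdd_below ((\<lambda>t. p (x + t *\<^sub>R y) - t * p y) ` {0..})" for x
  proof (rule bdd_belowI2)
    fix t :: real assume "t \<in> {0..}"
    then have "t * p y = p ((x + t *\<^sub>R y) + - x)"
      using sublinear_scaleR[OF p, of t y] by simp
    also have "\<dots> \<le> p (x + t *\<^sub>R y) + p (- x)"
      by (rule sublinear_add[OF p])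
    finally show "- p (- x) \<le> p (x + t *\<^sub>R y) - t * p y" by simp
  qed
  have lower: "q x \<le> p (x + t *\<^sub>R y) - t * p y" if "t \<ge> 0" for x t
    unfolding q_def by (rule cINF_lower[OF bdd]) (use that in simp)
  have greatest: "c \<le> q x" if "\<And>t. t \<ge> 0 \<Longrightarrow> c \<le> p (x + t *\<^sub>R y) - t * p y" for c x
    unfolding q_def by (rule cINF_greatest) (use that in auto)
  have "sublinear q"
  proof (rule sublinearI)
    fix x1 x2
    \<comment> \<open>The parameters \<open>t\<close> for \<open>x1\<close> and \<open>s\<close> for
      \<open>x2\<close> are matched by \<open>t + s\<close> for the sum; the infimum is taken over
      \<open>t\<close> and, after rearranging, over \<open>s\<close>.\<close>
    have "q (x1 + x2) - (p (x2 + s *\<^sub>R y) - s * p y) \<le> q x1" if s: "s \<ge> 0" for s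
    proof (rule greatest)
      fix t :: real assume t: "t \<ge> 0"
      have "p (x1 + x2 + (t + s) *\<^sub>R y) = p ((x1 + t *\<^sub>R y) + (x2 + s *\<^sub>R y))"
        by (simp add: algebra_simps)
      also have "\<dots> \<le> p (x1 + t *\<^sub>R y) + p (x2 + s *\<^sub>R y)"
        by (rule sublinear_add[OF p])
      finally show "q (x1 + x2) - (p (x2 + s *\<^sub>R y) - s * p y) \<le> p (x1 + t *\<^sub>R y) - t * p y"
        using lower[of "t + s" "x1 + x2"] s t by (simp add: algebra_simps)
    qed
    then have "q (x1 + x2) - q x1 \<le> q x2"
      by (intro greatest) (simp add: algebra_simps)
    then show "q (x1 + x2) \<le> q x1 + q x2" by simp
  next
    fix t :: real and x assume t: "t > 0"
    have "q (t *\<^sub>R x) / t \<le> q x"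
    proof (rule greatest)
      fix s :: real assume s: "s \<ge> 0"
      have "p (t *\<^sub>R x + (t * s) *\<^sub>R y) = t * p (x + s *\<^sub>R y)"
        using sublinear_scaleR[OF p, of t "x + s *\<^sub>R y"] t by (simp add: scaleR_add_right)
      then have "q (t *\<^sub>R x) \<le> t * (p (x + s *\<^sub>R y) - s * p y)"
        using lower[of "t * s" "t *\<^sub>R x"] s t by (simp add: algebra_simps)
      then show "q (t *\<^sub>R x) / t \<le> p (x + s *\<^sub>R y) - s * p y"
        using t by (simp add: field_simps)
    qed
    then show "q (t *\<^sub>R x) \<le> t * q x" using t by (simp add: field_simps)
  next
    have "q 0 \<le> 0" using lower[of 0 0] sublinear_zero[OF p] by simp
    moreover have "0 \<le> q 0"
      by (rule greatest) (simp add: sublinear_scaleR[OF p])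
    ultimately show "q 0 = 0" by simp
  qed
  moreover have "q x \<le> p x" for x using lower[of 0 x] by simp
  moreover have "q x \<le> p (x + y) - p y" for x using lower[of 1 x] by simp
  ultimately show ?thesis by (rule that)
qed

text \<open>Supplies the bound for Zorn's lemma as a pointwise infimum, finite because
  \<open>q x \<ge> - q (- x) \<ge> - p (- x)\<close>. Infima of sublinear functionals need not be
  subadditive; in a chain the smaller of two members serves both summands at once.\<close>

lemma sublinear_INF_chain:
  fixes C :: "('a::real_vector \<Rightarrow> real) set"
  assumes sub: "\<And>q. q \<in> C \<Longrightarrow> sublinear q \<and> q \<le> p" and "C \<noteq> {}"
    and chain: "\<And>q r. q \<in> C \<Longrightarrow> r \<in> C \<Longrightarrow> q \<le> r \<or> r \<le> q"
  obtains u where "sublinear u" "\<And>q. q \<in> C \<Longrightarrow> u \<le> q"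
proof -
  define u where "u x = (INF q\<in>C. q x)" for x
  have bdd: "bdd_below ((\<lambda>q. q x) ` C)" for x
  proof (rule bdd_belowI2)
    fix q assume "q \<in> C"
    then have "sublinear q" "q (- x) \<le> p (- x)" using sub by (auto simp: le_fun_def)
    then show "- p (- x) \<le> q x" using sublinear_ge[of q x] by simp
  qed
  have lower: "u x \<le> q x" if "q \<in> C" for q x
    unfolding u_def by (rule cINF_lower[OF bdd that])
  have greatest: "c \<le> u x" if "\<And>q. q \<in> C \<Longrightarrow> c \<le> q x" for c x
    unfolding u_def by (rule cINF_greatest) (use that \<open>C \<noteq> {}\<close> in auto)
  have "sublinear u"
  proof (rule sublinearI)
    fix x y
    have "u (x + y) \<le> q x + r y" if "q \<in> C" "r \<in> C" for q r
    proof -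
      obtain s where s: "s \<in> C" "s \<le> q" "s \<le> r"
        using chain[OF \<open>q \<in> C\<close> \<open>r \<in> C\<close>] \<open>q \<in> C\<close> \<open>r \<in> C\<close> by (metis order_refl)
      have "u (x + y) \<le> s x + s y"
        using lower[OF s(1), of "x + y"] sublinear_add[of s x y] sub[OF s(1)] by linarith
      then show ?thesis using s(2,3) by (force simp: le_fun_def dest: spec[of _ x] spec[of _ y])
    qed
    then have "u (x + y) - r y \<le> u x" if "r \<in> C" for r
      using that by (intro greatest) (simp add: algebra_simps)
    then have "u (x + y) - u x \<le> u y"
      by (intro greatest) (simp add: algebra_simps)
    then show "u (x + y) \<le> u x + u y" by simp
  next
    fix t :: real and x assume t: "t > 0"
    have "u (t *\<^sub>R x) / t \<le> u x"
      using lower[of _ "t *\<^sub>R x"] sub t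
      by (intro greatest) (simp add: sublinear_scaleR field_simps)
    then show "u (t *\<^sub>R x) \<le> t * u x" using t by (simp add: field_simps)
  next
    show "u 0 = 0"
      unfolding u_def using sub \<open>C \<noteq> {}\<close> by (simp add: sublinear_zero)
  qed
  then show ?thesis using that lower by (auto simp: le_fun_def)
qed

text \<open>A minimal sublinear functional is additive because it coincides with all its shifts.\<close>

lemma linear_below_sublinear:
  fixes p :: "'a::real_vector \<Rightarrow> real"
  assumes p: "sublinear p"
  obtains l where "linear l" "\<And>x. l x \<le> p x"
proof -
  define A where "A = {q. sublinear q \<and> q \<le> p}"
  \<comment> \<open>The order is reversed so that Zorn's lemma delivers a minimal
    functional.\<close>
  let ?P = "\<lambda>a b :: 'a \<Rightarrow> real. b \<le> a"
  have "\<exists>m\<in>A. \<forall>a\<in>A. ?P m a \<longrightarrow> a = m"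
  proof (rule predicate_Zorn)
    show "partial_order_on A (relation_of ?P A)"
      by (rule partial_order_on_relation_ofI) auto
  next
    fix C assume C: "C \<in> Chains (relation_of ?P A)"
    then have CA: "q \<in> A" if "q \<in> C" for q
      using that unfolding Chains_def relation_of_def by blast
    have chain: "q \<le> r \<or> r \<le> q" if "q \<in> C" "r \<in> C" for q r
      using C that unfolding Chains_def relation_of_def by blast
    show "\<exists>u\<in>A. \<forall>a\<in>C. u \<le> a"
    proof (cases "C = {}")
      case True
      then show ?thesis using p by (auto simp: A_def)
    next
      case False
      obtain u where u: "sublinear u" "\<And>q. q \<in> C \<Longrightarrow> u \<le> q"
        by (rule sublinear_INF_chain[of C p]) (use CA chain False in \<open>auto simp: A_def\<close>)
      from False obtain q where "q \<in> C" by blast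
      then have "u \<le> p" using u(2) CA order_trans unfolding A_def by blast
      then show ?thesis using u by (auto simp: A_def)
    qed
  qed
  then obtain l where l: "sublinear l" "l \<le> p" and min: "\<And>q. sublinear q \<Longrightarrow> q \<le> l \<Longrightarrow> q = l"
    unfolding A_def using order_trans by blast
  have add: "l (x + y) = l x + l y" for x y
  proof -
    obtain q where q: "sublinear q" "\<And>x. q x \<le> l x" "\<And>x. q x \<le> l (x + y) - l y"
      using sublinear_shift[OF l(1)] by metis
    have "q = l" by (rule min) (use q in \<open>auto simp: le_fun_def\<close>)
    then show ?thesis using q(3)[of x] sublinear_add[OF l(1), of x y] by simp
  qed
  have neg: "l (- x) = - l x" for x
    using add[of x "- x"] sublinear_zero[OF l(1)] by simp
  have "l (t *\<^sub>R x) = t * l x" for t x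
  proof (cases "t \<ge> 0")
    case False
    then have "l ((- t) *\<^sub>R x) = - t * l x" by (intro sublinear_scaleR[OF l(1)]) simp
    then show ?thesis by (simp add: neg)
  qed (rule sublinear_scaleR[OF l(1)])
  then have "linear l" by (intro linearI) (auto simp: add)
  then show ?thesis using that l(2) by (auto simp: le_fun_def)
qed

definition unit_functional :: "('a::complex_normed_vector \<Rightarrow> complex) \<Rightarrow> bool" where
  "unit_functional l \<longleftrightarrow> (\<forall>x y. l (x + y) = l x + l y) \<and> (\<forall>c x. l (c *\<^sub>C x) = c * l x) \<and>
    (\<forall>x. cmod (l x) \<le> norm x)"

text \<open>Shifting \<open>norm\<close> by \<open>x0\<close> takes the place of extending from a
  subspace: a real linear \<open>k\<close> below the shift has
  \<open>k (- x0) \<le> - norm x0\<close>, hence \<open>k x0 \<ge> norm x0\<close>. Complexifying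
  \<open>k\<close> preserves both bounds.\<close>

lemma unit_functional_exists:
  fixes x0 :: "'a::complex_normed_vector"
  obtains l where "unit_functional l" "norm x0 \<le> cmod (l x0)"
proof -
  have "sublinear (norm :: 'a \<Rightarrow> real)"
    by (auto simp: sublinear_def norm_triangle_ineq)
  then obtain q where q: "sublinear q" "\<And>x. q x \<le> norm x" "\<And>x. q x \<le> norm (x + x0) - norm x0"
    using sublinear_shift[of norm x0] by blast
  obtain k where k: "linear k" "\<And>x. k x \<le> q x"
    using linear_below_sublinear[OF q(1)] by blast
  interpret k: linear k by (rule k(1))
  have kle: "k x \<le> norm x" for x using k(2)[of x] q(2)[of x] by simp
  have "k (- x0) \<le> - norm x0" using k(2)[of "- x0"] q(3)[of "- x0"] by simp
  then have kx0: "norm x0 \<le> k x0" by (simp add: k.neg)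
  \<comment> \<open>A complex linear functional is determined by its real part, since
    \<open>Im (l x) = - Re (l (\<i> *\<^sub>C x))\<close>.\<close>
  define l where "l x = Complex (k x) (- k (\<i> *\<^sub>C x))" for x
  have split: "c *\<^sub>C x = Re c *\<^sub>R x + Im c *\<^sub>R (\<i> *\<^sub>C x)" for c and x :: 'a
    unfolding scaleR_scaleC scaleC_scaleC scaleC_add_left[symmetric]
    by (simp add: complex_eq[of c, symmetric] mult.commute)
  have add: "l (x + y) = l x + l y" for x y
    by (simp add: l_def scaleC_add_right k.add complex_eq_iff)
  have ii: "\<i> *\<^sub>C (\<i> *\<^sub>C x) = - x" for x :: 'a
    by (simp add: scaleC_scaleC scaleC_minus_one)
  have scale: "l (c *\<^sub>C x) = c * l x" for c x
  proof -
    have "k (c *\<^sub>C x) = Re c * k x + Im c * k (\<i> *\<^sub>C x)" for x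
      unfolding split[of c x] by (simp only: k.add k.scale real_scaleR_def)
    moreover have "k (\<i> *\<^sub>C (c *\<^sub>C x)) = Re c * k (\<i> *\<^sub>C x) - Im c * k x"
    proof -
      have "\<i> *\<^sub>C (c *\<^sub>C x) = c *\<^sub>C (\<i> *\<^sub>C x)" by (simp add: scaleC_scaleC mult.commute)
      then show ?thesis using calculation[of "\<i> *\<^sub>C x"] by (simp add: ii k.neg)
    qed
    ultimately show ?thesis by (simp add: l_def complex_eq_iff algebra_simps)
  qed
  have "cmod (l x) \<le> norm x" for x
  proof (cases "l x = 0")
    case False
    \<comment> \<open>A unimodular factor rotating \<open>l x\<close> onto the positive real axis,
      where \<open>l\<close> agrees with \<open>k\<close>.\<close>
    define c where "c = cnj (l x) / cmod (l x)"
    have c1: "cmod c = 1" using False by (simp add: c_def norm_divide)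
    have "l (c *\<^sub>C x) = cnj (l x) * l x / cmod (l x)" by (simp add: scale c_def)
    also have "cnj (l x) * l x = of_real (cmod (l x) ^ 2)"
      by (metis complex_norm_square mult.commute of_real_power)
    finally have "l (c *\<^sub>C x) = of_real (cmod (l x))"
      using False by (simp add: power2_eq_square)
    then have "cmod (l x) = k (c *\<^sub>C x)" by (simp add: l_def complex_eq_iff)
    also have "\<dots> \<le> norm x" using kle[of "c *\<^sub>C x"] c1 by (simp add: norm_scaleC)
    finally show ?thesis .
  qed simp
  with add scale have "unit_functional l" by (auto simp: unit_functional_def)
  moreover have "norm x0 \<le> cmod (l x0)"
    using kx0 complex_Re_le_cmod[of "l x0"] by (simp add: l_def)
  ultimately show ?thesis by (rule that)
qed

lemma norm_leI_unit_functional: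
  assumes "\<And>l. unit_functional l \<Longrightarrow> cmod (l x) \<le> K"
  shows "norm x \<le> K"
  by (meson assms order_trans unit_functional_exists)

lemma unit_functional_add: "unit_functional l \<Longrightarrow> l (x + y) = l x + l y"
  and unit_functional_scaleC: "unit_functional l \<Longrightarrow> l (c *\<^sub>C x) = c * l x"
  and unit_functional_norm: "unit_functional l \<Longrightarrow> cmod (l x) \<le> norm x"
  by (auto simp: unit_functional_def)

lemma bounded_linear_unit_functional:
  assumes "unit_functional l"
  shows "bounded_linear l"
  by (rule bounded_linear_intro[where K = 1])
    (use assms in \<open>auto simp: unit_functional_def scaleR_conv_of_real scaleR_scaleC[where 'a = 'a]\<close>)

section \<open>Taylor remainders and Cauchy's inequalities on complex lines\<close>

definition taylor_coeff :: "(complex \<Rightarrow> complex) \<Rightarrow> nat \<Rightarrow> complex" where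
  "taylor_coeff u n = (deriv ^^ n) u 0 / fact n"

text \<open>Cauchy's inequality bounds the coefficients by \<open>M / R ^ m\<close>. As
  \<open>cmod w \<le> R / 2\<close>, the tail is at most \<open>M * (cmod w / R) ^ n\<close> times a
  geometric series of ratio 1/2, whose sum is the factor 2.\<close>

lemma taylor_remainder:
  assumes u: "u holomorphic_on UNIV" and R: "R > 0"
    and M: "\<And>z. cmod z \<le> R \<Longrightarrow> cmod (u z) \<le> M" and w: "cmod w \<le> R / 2"
  shows "cmod (u w - (\<Sum>m<n. w ^ m * taylor_coeff u m)) \<le> 2 * M * (cmod w / R) ^ n"
proof -
  define q where "q = cmod w / R"
  have q: "0 \<le> q" "q \<le> 1 / 2" using w R by (auto simp: q_def field_simps)
  have M0: "0 \<le> M" using M[of 0] R norm_ge_zero[of "u 0"] by (simp del: norm_ge_zero)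
  have coeff: "cmod (taylor_coeff u m) \<le> M / R ^ m" for m
  proof -
    have "cmod ((deriv ^^ m) u 0) \<le> fact m * M / R ^ m"
      by (rule Cauchy_inequality)
        (use u R M in \<open>auto intro: holomorphic_on_subset holomorphic_on_imp_continuous_on
            continuous_on_subset\<close>)
    then show ?thesis by (simp add: taylor_coeff_def norm_divide field_simps)
  qed
  have "(\<lambda>m. (deriv ^^ m) u 0 / fact m * (w - 0) ^ m) sums u w"
    by (rule holomorphic_power_series[where r = "cmod w + 1"])
      (use u in \<open>auto intro: holomorphic_on_subset\<close>)
  then have "(\<lambda>m. w ^ m * taylor_coeff u m) sums u w"
    by (simp add: taylor_coeff_def mult.commute)
  then have "(\<lambda>i. w ^ (i + n) * taylor_coeff u (i + n)) sums
      (u w - (\<Sum>m<n. w ^ m * taylor_coeff u m))"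
    by (rule sums_split_initial_segment)
  moreover have "(\<lambda>i. M * q ^ n * (1 / 2) ^ i) sums (M * q ^ n * (1 / (1 - 1 / 2)))"
    by (intro sums_mult geometric_sums) simp
  moreover have "cmod (w ^ (i + n) * taylor_coeff u (i + n)) \<le> M * q ^ n * (1 / 2) ^ i" for i
  proof -
    have "cmod (w ^ (i + n) * taylor_coeff u (i + n)) \<le> cmod w ^ (i + n) * (M / R ^ (i + n))"
      unfolding norm_mult norm_power by (intro mult_left_mono coeff) simp
    also have "\<dots> = M * q ^ n * q ^ i"
      by (simp add: q_def power_divide power_add mult_ac)
    also have "\<dots> \<le> M * q ^ n * (1 / 2) ^ i"
      using q M0 by (intro mult_left_mono power_mono) auto
    finally show ?thesis .
  qed
  ultimately show ?thesis
    using norm_sums_le by (fastforce simp: q_def mult_ac)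
qed

text \<open>Complex homogeneity of \<open>D\<close> turns the real derivative along the line into
  multiplication by the number \<open>l (D b)\<close>, which is complex differentiability.\<close>

lemma holomorphic_line:
  assumes F: "\<And>x. complex_frechet_differentiable F x" and l: "unit_functional l"
  shows "(\<lambda>z. l (F (a + z *\<^sub>C b))) holomorphic_on S"
    and "(F has_derivative D) (at a) \<Longrightarrow> (\<And>c v. D (c *\<^sub>C v) = c *\<^sub>C D v) \<Longrightarrow>
      deriv (\<lambda>z. l (F (a + z *\<^sub>C b))) 0 = l (D b)"
proof -
  have line: "((\<lambda>z. a + z *\<^sub>C b) has_derivative (\<lambda>t. t *\<^sub>C b)) (at z)" for z
  proof -
    have "bounded_linear (\<lambda>t. t *\<^sub>C b)"
      by (rule bounded_linear_intro[where K = "norm b"])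
        (auto simp: scaleC_add_left scaleR_scaleC[where 'a = 'a] scaleC_scaleC norm_scaleC
            scaleR_conv_of_real)
    then show ?thesis
      using has_derivative_add[OF has_derivative_const bounded_linear_imp_has_derivative] by fastforce
  qed
  have deriv: "((\<lambda>z. l (F (a + z *\<^sub>C b))) has_field_derivative l (D b)) (at z)"
    if D: "(F has_derivative D) (at (a + z *\<^sub>C b))" "\<And>c v. D (c *\<^sub>C v) = c *\<^sub>C D v" for z D
  proof -
    have "((\<lambda>z. l (F (a + z *\<^sub>C b))) has_derivative (\<lambda>t. l (D (t *\<^sub>C b)))) (at z)"
      by (rule bounded_linear.has_derivative[OF bounded_linear_unit_functional[OF l]])
        (rule has_derivative_compose[OF line D(1)])
    moreover have "(\<lambda>t. l (D (t *\<^sub>C b))) = (*) (l (D b))"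
      by (auto simp: D(2) unit_functional_scaleC[OF l])
    ultimately show ?thesis by (simp add: has_field_derivative_def)
  qed
  show "(\<lambda>z. l (F (a + z *\<^sub>C b))) holomorphic_on S"
    unfolding holomorphic_on_def field_differentiable_def
    using F deriv has_field_derivative_at_within unfolding complex_frechet_differentiable_def by meson
  assume "(F has_derivative D) (at a)" "\<And>c v. D (c *\<^sub>C v) = c *\<^sub>C D v"
  moreover have "0 *\<^sub>C b = 0" using scaleC_add_left[of 0 0 b] by simp
  ultimately show "deriv (\<lambda>z. l (F (a + z *\<^sub>C b))) 0 = l (D b)"
    using deriv[where z = 0] by (intro DERIV_imp_deriv) simp
qed

text \<open>For \<open>h \<noteq> 0\<close> the disc of radius \<open>1 / norm h\<close> is mapped
  by \<open>x + z *\<^sub>C h\<close> into the unit ball around \<open>x\<close>; Cauchy's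
  inequality for the first derivative on this disc gives \<open>M * norm h\<close>.\<close>

lemma cauchy_derivative_bound:
  assumes F: "\<And>x. complex_frechet_differentiable F x"
    and D: "(F has_derivative D) (at x)" "\<And>c v. D (c *\<^sub>C v) = c *\<^sub>C D v"
    and M: "\<And>y. norm (y - x) \<le> 1 \<Longrightarrow> norm (F y) \<le> M"
  shows "norm (D h) \<le> M * norm h"
proof (cases "h = 0")
  case True
  then show ?thesis using has_derivative_bounded_linear[OF D(1)]
    by (simp add: linear_simps)
next
  case False
  show ?thesis
  proof (rule norm_leI_unit_functional)
    fix l assume l: "unit_functional (l :: 'b \<Rightarrow> complex)"
    let ?u = "\<lambda>z. l (F (x + z *\<^sub>C h))"
    have "cmod ((deriv ^^ 1) ?u 0) \<le> fact 1 * M / (1 / norm h) ^ 1"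
    proof (rule Cauchy_inequality)
      show "cmod (?u z) \<le> M" if "cmod (0 - z) = 1 / norm h" for z
        using that False
        by (intro order_trans[OF unit_functional_norm[OF l] M]) (simp add: norm_scaleC)
    qed (use False in \<open>auto intro!: holomorphic_line(1)[OF F l] holomorphic_on_imp_continuous_on\<close>)
    then show "cmod (l (D h)) \<le> M * norm h"
      using holomorphic_line(2)[OF F l D] by simp
  qed
qed

text \<open>This is \<open>taylor_remainder\<close> of order 1 on the line through \<open>x\<close>
  and \<open>y\<close>, at \<open>w = 1\<close> with radius \<open>1 / norm (y - x)\<close>;
  distance at most 1/2 puts 1 within half that radius.\<close>

lemma lipschitz_estimate:
  assumes F: "\<And>x. complex_frechet_differentiable F x"
    and M: "\<And>y. norm (y - x) \<le> 1 \<Longrightarrow> norm (F y) \<le> M" and y: "norm (y - x) \<le> 1 / 2"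
  shows "norm (F y - F x) \<le> 2 * M * norm (y - x)"
proof (cases "y = x")
  case False
  show ?thesis
  proof (rule norm_leI_unit_functional)
    fix l assume l: "unit_functional (l :: 'b \<Rightarrow> complex)"
    let ?u = "\<lambda>z. l (F (x + z *\<^sub>C (y - x)))"
    have zero: "0 *\<^sub>C (y - x) = 0" using scaleC_add_left[of 0 0 "y - x"] by simp
    have "cmod (?u 1 - (\<Sum>m<1. 1 ^ m * taylor_coeff ?u m))
        \<le> 2 * M * (cmod 1 / (1 / norm (y - x))) ^ 1"
    proof (rule taylor_remainder)
      show "cmod (?u z) \<le> M" if "cmod z \<le> 1 / norm (y - x)" for z
        using that False
        by (intro order_trans[OF unit_functional_norm[OF l] M]) (simp add: norm_scaleC field_simps)
    qed (use False y in \<open>auto intro: holomorphic_line(1)[OF F l] simp: field_simps\<close>)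
    then have "cmod (l (F y) - l (F x)) \<le> 2 * M * norm (y - x)"
      by (simp add: taylor_coeff_def zero scaleC_one)
    moreover have "l (F y - F x) = l (F y) - l (F x)"
      by (rule linear_diff[OF bounded_linear.linear[OF bounded_linear_unit_functional[OF l]]])
    ultimately show "cmod (l (F y - F x)) \<le> 2 * M * norm (y - x)" by simp
  qed
qed simp

section \<open>Completeness of H_b and power series in it\<close>

lemma Hb_differentiable: "complex_frechet_differentiable (Hb_apply f) x"
  and Hb_bounded_image: "bounded B \<Longrightarrow> bounded (Hb_apply f ` B)"
  using Hb_apply[of f] by (auto simp: holomorphic_bounded_type_def)

lemma Hb_apply_sum: "Hb_apply (\<Sum>i\<in>A. f i) x = (\<Sum>i\<in>A. Hb_apply (f i) x)"
  by (induction A rule: infinite_finite_induct) (auto simp: zero_Hb.rep_eq plus_Hb.rep_eq)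

text \<open>For differentiability, \<open>cauchy_derivative_bound\<close> applied to
  \<open>q m - q n\<close> makes the derivatives uniformly Cauchy in operator norm near
  \<open>x0\<close>, so term-by-term differentiation applies; complex homogeneity survives the
  pointwise limit.\<close>

lemma holomorphic_bounded_type_uniform_limit:
  fixes q :: "nat \<Rightarrow> ('a::complex_normed_vector, 'b::complex_banach) Hb"
  assumes Q: "\<And>B. bounded B \<Longrightarrow> uniform_limit B (\<lambda>n. Hb_apply (q n)) Q sequentially"
  shows "holomorphic_bounded_type Q"
  unfolding holomorphic_bounded_type_def
proof (intro conjI allI impI)
  fix B :: "'a set" assume "bounded B"
  then have "\<forall>\<^sub>F n in sequentially. \<forall>x\<in>B. dist (Hb_apply (q n) x) (Q x) < 1"
    using Q uniform_limitD zero_less_one by blast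
  then obtain n where n: "\<And>x. x \<in> B \<Longrightarrow> dist (Hb_apply (q n) x) (Q x) < 1"
    by (auto simp: eventually_sequentially)
  obtain K where K: "\<And>x. x \<in> B \<Longrightarrow> norm (Hb_apply (q n) x) \<le> K"
    using Hb_bounded_image[OF \<open>bounded B\<close>, of "q n"] by (auto simp: bounded_iff)
  have "norm (Q x) \<le> K + 1" if "x \<in> B" for x
    using n[OF that] K[OF that] norm_triangle_ineq2[of "Q x" "Hb_apply (q n) x"]
    by (simp add: dist_norm norm_minus_commute)
  then show "bounded (Q ` B)" by (auto simp: bounded_iff)
next
  fix x0 :: 'a
  have "\<forall>n x. \<exists>D. (Hb_apply (q n) has_derivative D) (at x) \<and> (\<forall>c v. D (c *\<^sub>C v) = c *\<^sub>C D v)"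
    using Hb_differentiable unfolding complex_frechet_differentiable_def by blast
  then obtain D where D: "\<And>n x. (Hb_apply (q n) has_derivative D n x) (at x)"
      and Dc: "\<And>n x c v. D n x (c *\<^sub>C v) = c *\<^sub>C D n x v"
    by metis
  define S where "S = ball x0 1"
  have ev: "\<exists>N. \<forall>m\<ge>N. \<forall>n\<ge>N. \<forall>x\<in>S. \<forall>h. norm (D m x h - D n x h) \<le> e * norm h" if "e > 0" for e
  proof -
    \<comment> \<open>Radius 2 covers the unit balls around all points of \<open>S\<close>, where
      \<open>cauchy_derivative_bound\<close> wants its bound; \<open>e / 2\<close> is spent once on
      \<open>q m\<close> and once on \<open>q n\<close>.\<close>
    have "\<forall>\<^sub>F n in sequentially. \<forall>x\<in>cball x0 2. dist (Hb_apply (q n) x) (Q x) < e / 2"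
      using Q[OF bounded_cball] \<open>e > 0\<close> by (intro uniform_limitD) auto
    then obtain N where N: "\<And>n x. n \<ge> N \<Longrightarrow> dist x0 x \<le> 2 \<Longrightarrow> dist (Hb_apply (q n) x) (Q x) < e / 2"
      unfolding eventually_sequentially by (metis mem_cball)
    have "norm (D m x h - D n x h) \<le> e * norm h" if mn: "m \<ge> N" "n \<ge> N" and x: "x \<in> S" for m n x h
    proof (rule cauchy_derivative_bound[where F = "Hb_apply (q m - q n)" and x = x and
          D = "\<lambda>h. D m x h - D n x h"])
      show "(Hb_apply (q m - q n) has_derivative (\<lambda>h. D m x h - D n x h)) (at x)"
        unfolding minus_Hb.rep_eq by (intro has_derivative_diff D)
      show "D m x (c *\<^sub>C v) - D n x (c *\<^sub>C v) = c *\<^sub>C (D m x v - D n x v)" for c v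
        using scaleC_add_right[of c "D m x v" "- D n x v"] by (simp add: Dc scaleC_minus_right)
      fix y assume y: "norm (y - x) \<le> 1"
      have "dist x0 y \<le> 2"
        using dist_triangle[of x0 y x] x y by (simp add: S_def dist_norm norm_minus_commute)
      then have "dist (Hb_apply (q m) y) (Q y) < e / 2" "dist (Hb_apply (q n) y) (Q y) < e / 2"
        using N mn by auto
      then show "norm (Hb_apply (q m - q n) y) \<le> e"
        using dist_triangle_half_l[of "Hb_apply (q m) y" "Q y" e "Hb_apply (q n) y"]
        by (simp add: minus_Hb.rep_eq dist_norm norm_minus_commute)
    qed (rule Hb_differentiable)
    then show ?thesis by blast
  qed
  define D' where "D' x h = lim (\<lambda>n. D n x h)" for x h
  have lim: "(\<lambda>n. D n x h) \<longlonglongrightarrow> D' x h" if "x \<in> S" for x h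
  proof -
    have "Cauchy (\<lambda>n. D n x h)"
      unfolding Cauchy_iff
    proof (intro allI impI)
      fix e :: real assume e: "e > 0"
      \<comment> \<open>Adding 1 covers \<open>h = 0\<close> and makes the final inequality
        strict.\<close>
      then have "e / (norm h + 1) > 0"
        by (intro divide_pos_pos add_nonneg_pos) auto
      from ev[OF this] obtain N where
        "\<forall>m\<ge>N. \<forall>n\<ge>N. \<forall>x\<in>S. \<forall>k. norm (D m x k - D n x k) \<le> e / (norm h + 1) * norm k" ..
      with that have
        N: "\<forall>m\<ge>N. \<forall>n\<ge>N. norm (D m x h - D n x h) \<le> e / (norm h + 1) * norm h"
        by simp
      have "e / (norm h + 1) * norm h < e"
        using e by (simp add: divide_less_eq add_nonneg_pos distrib_left)
      then show "\<exists>M. \<forall>m\<ge>M. \<forall>n\<ge>M. norm (D m x h - D n x h) < e"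
        using N by (meson le_less_trans)
    qed
    then show ?thesis
      unfolding D'_def by (simp add: Cauchy_convergent_iff convergent_LIMSEQ_iff)
  qed
  have "\<exists>g. \<forall>x\<in>S. (\<lambda>n. Hb_apply (q n) x) \<longlonglongrightarrow> g x \<and> (g has_derivative D' x) (at x within S)"
  proof (rule has_derivative_sequence)
    show "convex S" "x0 \<in> S" by (auto simp: S_def)
    show "(Hb_apply (q n) has_derivative D n x) (at x within S)" for n x
      by (rule has_derivative_at_withinI[OF D])
    show "(\<lambda>n. Hb_apply (q n) x0) \<longlonglongrightarrow> Q x0"
      using tendsto_uniform_limitI[OF Q[of "{x0}"]] by simp
    fix e :: real assume "e > 0"
    from ev[OF this] obtain N where
      N: "\<And>m n x h. m \<ge> N \<Longrightarrow> n \<ge> N \<Longrightarrow> x \<in> S \<Longrightarrow> norm (D m x h - D n x h) \<le> e * norm h"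
      by blast
    \<comment> \<open>Let \<open>n\<close> tend to infinity in the Cauchy estimate with
      \<open>m\<close> fixed.\<close>
    have "norm (D m x h - D' x h) \<le> e * norm h" if "m \<ge> N" "x \<in> S" for m x h
      by (rule tendsto_upperbound[OF tendsto_norm[OF tendsto_diff[OF tendsto_const lim]]])
        (use N that in \<open>auto simp: eventually_sequentially intro!: exI[of _ N]\<close>)
    then show "\<forall>\<^sub>F n in sequentially. \<forall>x\<in>S. \<forall>h. norm (D n x h - D' x h) \<le> e * norm h"
      unfolding eventually_sequentially by blast
  qed
  then obtain g where g: "\<And>x. x \<in> S \<Longrightarrow> (\<lambda>n. Hb_apply (q n) x) \<longlonglongrightarrow> g x"
      "\<And>x. x \<in> S \<Longrightarrow> (g has_derivative D' x) (at x within S)"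
    by blast
  have S: "open S" "x0 \<in> S" by (auto simp: S_def)
  have gQ: "g x = Q x" if "x \<in> S" for x
    using LIMSEQ_unique[OF g(1)[OF that]] tendsto_uniform_limitI[OF Q[of "{x}"]] by simp
  have "(g has_derivative D' x0) (at x0)"
    using g(2)[OF S(2)] unfolding at_within_open[OF S(2) S(1)] .
  then have "(Q has_derivative D' x0) (at x0)"
    by (rule has_derivative_transform_within_open[OF _ S gQ])
  moreover have "D' x0 (c *\<^sub>C v) = c *\<^sub>C D' x0 v" for c v
  proof (rule LIMSEQ_unique[OF lim[OF S(2)]])
    show "(\<lambda>n. D n x0 (c *\<^sub>C v)) \<longlonglongrightarrow> c *\<^sub>C D' x0 v"
      unfolding Dc by (rule bounded_linear.tendsto[OF bounded_linear_scaleC lim[OF S(2)]])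
  qed
  ultimately show "complex_frechet_differentiable Q x0"
    unfolding complex_frechet_differentiable_def by blast
qed

lemma Hb_complete:
  fixes q :: "nat \<Rightarrow> ('a::complex_normed_vector, 'b::complex_banach) Hb"
  assumes "\<And>B. bounded B \<Longrightarrow> uniformly_Cauchy_on B (\<lambda>n. Hb_apply (q n))"
  obtains h where "q \<longlonglongrightarrow> h"
proof -
  define Q where "Q x = lim (\<lambda>n. Hb_apply (q n) x)" for x
  have Q: "uniform_limit B (\<lambda>n. Hb_apply (q n)) Q sequentially" if "bounded B" for B
    using Cauchy_uniformly_convergent[OF assms[OF that]]
    by (simp add: uniformly_convergent_uniform_limit_iff Q_def[abs_def])
  then have "Hb_apply (Abs_Hb Q) = Q"
    using holomorphic_bounded_type_uniform_limit by (intro Abs_Hb_inverse) blast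
  then have "q \<longlonglongrightarrow> Abs_Hb Q"
    using Q by (simp add: tendsto_Hb_iff)
  then show ?thesis by (rule that)
qed

text \<open>The Taylor coefficients are obtained recursively: the \<open>n\<close>-th one is the limit, as \<open>w\<close> tends
  to \<open>0\<close>, of the remainder of order \<open>n\<close> divided by \<open>w ^ n\<close>. Functionals reduce the uniform
  estimates to scalar ones.\<close>

lemma Hb_taylor_coeff:
  fixes \<Phi> :: "complex \<Rightarrow> ('a::complex_normed_vector, 'b::complex_banach) Hb"
  assumes hol: "\<And>l x. unit_functional l \<Longrightarrow> (\<lambda>w. l (Hb_apply (\<Phi> w) x)) holomorphic_on UNIV"
    and bdd: "\<And>B R. bounded B \<Longrightarrow>
      \<exists>M. \<forall>w x. cmod w \<le> R \<longrightarrow> x \<in> B \<longrightarrow> norm (Hb_apply (\<Phi> w) x) \<le> M"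
  shows "\<exists>h. \<forall>l x. unit_functional l \<longrightarrow>
    l (Hb_apply h x) = taylor_coeff (\<lambda>w. l (Hb_apply (\<Phi> w) x)) n"
proof (induction n rule: less_induct)
  case (less n)
  then obtain c where c: "\<And>m l x. m < n \<Longrightarrow> unit_functional l \<Longrightarrow>
      l (Hb_apply (c m) x) = taylor_coeff (\<lambda>w. l (Hb_apply (\<Phi> w) x)) m"
    by metis
  define w :: "nat \<Rightarrow> complex" where "w j = of_real (inverse (real (Suc j)))" for j
  have w0: "w j \<noteq> 0" and w1: "cmod (w j) \<le> 1" for j
    by (auto simp: w_def norm_divide norm_inverse field_simps simp del: of_nat_Suc)
  have wlim: "(\<lambda>j. cmod (w j)) \<longlonglongrightarrow> 0"
    using LIMSEQ_inverse_real_of_nat by (simp add: w_def norm_inverse del: of_nat_Suc)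
  define q where "q j = inverse (w j ^ n) *\<^sub>C (\<Phi> (w j) - (\<Sum>m<n. w j ^ m *\<^sub>C c m))" for j
  have lq: "l (Hb_apply (q j) x) = (l (Hb_apply (\<Phi> (w j)) x)
      - (\<Sum>m<n. w j ^ m * taylor_coeff (\<lambda>w. l (Hb_apply (\<Phi> w) x)) m)) / w j ^ n"
    if l: "unit_functional l" for l j x
  proof -
    have lin: "linear l" by (rule bounded_linear.linear[OF bounded_linear_unit_functional[OF l]])
    show ?thesis
      by (simp add: q_def scaleC_Hb.rep_eq minus_Hb.rep_eq Hb_apply_sum unit_functional_scaleC[OF l]
          linear_diff[OF lin] linear_sum[OF lin] c[OF _ l] field_simps)
  qed
  \<comment> \<open>The remainder of order \<open>Suc n\<close> is of size
    \<open>cmod (w j) ^ Suc n\<close>, so dividing by \<open>w j ^ n\<close> leaves one factor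
    \<open>cmod (w j)\<close>. One \<open>M\<close> serves all functionals, which later yields norm
    estimates.\<close>
  have approx: "\<exists>M\<ge>0. \<forall>x\<in>B. \<forall>l j. unit_functional l \<longrightarrow> cmod (l (Hb_apply (q j) x)
      - taylor_coeff (\<lambda>w. l (Hb_apply (\<Phi> w) x)) n) \<le> M * cmod (w j)" if B: "bounded B" for B
  proof -
    obtain M where M: "\<And>w x. cmod w \<le> 2 \<Longrightarrow> x \<in> B \<Longrightarrow> norm (Hb_apply (\<Phi> w) x) \<le> M"
      using bdd[OF B] by blast
    \<comment> \<open>\<open>max M 0\<close> covers an empty \<open>B\<close>, where nothing makes
      \<open>M\<close> nonnegative.\<close>
    have "cmod (l (Hb_apply (q j) x) - taylor_coeff (\<lambda>w. l (Hb_apply (\<Phi> w) x)) n)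
        \<le> max M 0 * cmod (w j)" if x: "x \<in> B" and l: "unit_functional l" for x l j
    proof -
      let ?u = "\<lambda>w. l (Hb_apply (\<Phi> w) x)"
      have M0: "0 \<le> M" using order_trans[OF norm_ge_zero M[OF _ x, of 0]] by simp
      have "cmod (?u (w j) - (\<Sum>m<Suc n. w j ^ m * taylor_coeff ?u m))
          \<le> 2 * M * (cmod (w j) / 2) ^ Suc n"
        by (rule taylor_remainder[OF hol[OF l]])
          (use w1 in \<open>auto intro: order_trans[OF unit_functional_norm[OF l] M[OF _ x]]\<close>)
      also have "\<dots> \<le> M * cmod (w j) ^ Suc n"
      proof -
        have "M * cmod (w j) ^ Suc n * 1 \<le> M * cmod (w j) ^ Suc n * 2 ^ n"
          using M0 by (intro mult_left_mono) auto
        then show ?thesis by (simp add: power_divide field_simps)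
      qed
      also have "?u (w j) - (\<Sum>m<Suc n. w j ^ m * taylor_coeff ?u m)
          = (l (Hb_apply (q j) x) - taylor_coeff ?u n) * w j ^ n"
        using w0[of j] by (simp add: lq[OF l] field_simps)
      finally have "cmod (l (Hb_apply (q j) x) - taylor_coeff ?u n) * cmod (w j) ^ n
          \<le> (M * cmod (w j)) * cmod (w j) ^ n"
        by (simp add: norm_mult norm_power mult_ac)
      then show ?thesis using w0[of j] M0 by simp
    qed
    then show ?thesis by (intro exI[of _ "max M 0"]) auto
  qed
  have "uniformly_Cauchy_on B (\<lambda>j. Hb_apply (q j))" if B: "bounded B" for B
  proof (rule uniformly_Cauchy_onI)
    fix e :: real assume e: "e > 0"
    obtain M where M: "M \<ge> 0" "\<And>x l j. x \<in> B \<Longrightarrow> unit_functional l \<Longrightarrow> cmod (l (Hb_apply (q j) x)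
        - taylor_coeff (\<lambda>w. l (Hb_apply (\<Phi> w) x)) n) \<le> M * cmod (w j)"
      using approx[OF B] by blast
    have "(\<lambda>j. M * cmod (w j)) \<longlonglongrightarrow> 0" using tendsto_mult_right_zero[OF wlim] by simp
    then have "\<forall>\<^sub>F j in sequentially. M * cmod (w j) < e / 2"
      using e by (intro order_tendstoD(2)) auto
    then obtain N where N: "\<And>j. j \<ge> N \<Longrightarrow> M * cmod (w j) < e / 2"
      by (auto simp: eventually_sequentially)
    have "dist (Hb_apply (q i) x) (Hb_apply (q j) x) < e" if x: "x \<in> B" and ij: "i \<ge> N" "j \<ge> N" for x i j
    proof -
      \<comment> \<open>No vector limit is known yet: under each functional, both terms are compared
        with the same scalar Taylor coefficient.\<close>
      have "norm (Hb_apply (q i) x - Hb_apply (q j) x) \<le> M * cmod (w i) + M * cmod (w j)"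
      proof (rule norm_leI_unit_functional)
        fix l assume l: "unit_functional (l :: 'b \<Rightarrow> complex)"
        have "l (Hb_apply (q i) x - Hb_apply (q j) x) = l (Hb_apply (q i) x) - l (Hb_apply (q j) x)"
          by (rule linear_diff[OF bounded_linear.linear[OF bounded_linear_unit_functional[OF l]]])
        then show "cmod (l (Hb_apply (q i) x - Hb_apply (q j) x)) \<le> M * cmod (w i) + M * cmod (w j)"
          using norm_triangle_ineq4[of "l (Hb_apply (q i) x) - taylor_coeff (\<lambda>w. l (Hb_apply (\<Phi> w) x)) n"
              "l (Hb_apply (q j) x) - taylor_coeff (\<lambda>w. l (Hb_apply (\<Phi> w) x)) n"]
            M(2)[OF x l, of i] M(2)[OF x l, of j] by simp
      qed
      then show ?thesis using N[OF ij(1)] N[OF ij(2)] by (simp add: dist_norm)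
    qed
    then show "\<exists>N. \<forall>x\<in>B. \<forall>i\<ge>N. \<forall>j\<ge>N. dist (Hb_apply (q i) x) (Hb_apply (q j) x) < e" by blast
  qed
  then obtain h where h: "q \<longlonglongrightarrow> h" using Hb_complete by blast
  have "l (Hb_apply h x) = taylor_coeff (\<lambda>w. l (Hb_apply (\<Phi> w) x)) n" if l: "unit_functional l" for l x
  proof (rule LIMSEQ_unique)
    have "(\<lambda>j. Hb_apply (q j) x) \<longlonglongrightarrow> Hb_apply h x"
      by (rule tendsto_uniform_limitI[OF h[unfolded tendsto_Hb_iff, rule_format, of "{x}"]]) auto
    then show "(\<lambda>j. l (Hb_apply (q j) x)) \<longlonglongrightarrow> l (Hb_apply h x)"
      by (rule bounded_linear.tendsto[OF bounded_linear_unit_functional[OF l]])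
    have "bounded {x}" by simp
    from approx[OF this] obtain M where "M \<ge> 0" "\<forall>y\<in>{x}. \<forall>l j. unit_functional l \<longrightarrow> cmod (l (Hb_apply (q j) y)
        - taylor_coeff (\<lambda>w. l (Hb_apply (\<Phi> w) y)) n) \<le> M * cmod (w j)"
      by (elim exE conjE) rule
    with l have "cmod (l (Hb_apply (q j) x)
        - taylor_coeff (\<lambda>w. l (Hb_apply (\<Phi> w) x)) n) \<le> M * cmod (w j)" for j
      by simp
    then have "(\<lambda>j. l (Hb_apply (q j) x) - taylor_coeff (\<lambda>w. l (Hb_apply (\<Phi> w) x)) n) \<longlonglongrightarrow> 0"
      by (rule Lim_null_comparison[OF always_eventually[OF allI] tendsto_mult_right_zero[OF wlim]])
    then show "(\<lambda>j. l (Hb_apply (q j) x)) \<longlonglongrightarrow> taylor_coeff (\<lambda>w. l (Hb_apply (\<Phi> w) x)) n"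
      by (rule LIM_zero_cancel)
  qed
  then show ?case by blast
qed

text \<open>Under each functional, \<open>\<Phi> w\<close> minus a partial sum is a scalar Taylor
  remainder, bounded independently of the functional and of the point in \<open>B\<close>.
  Boundedness on discs of every radius gives convergence at every \<open>w\<close>.\<close>

lemma Hb_power_series:
  fixes \<Phi> :: "complex \<Rightarrow> ('a::complex_normed_vector, 'b::complex_banach) Hb"
  assumes hol: "\<And>l x. unit_functional l \<Longrightarrow> (\<lambda>w. l (Hb_apply (\<Phi> w) x)) holomorphic_on UNIV"
    and bdd: "\<And>B R. bounded B \<Longrightarrow>
      \<exists>M. \<forall>w x. cmod w \<le> R \<longrightarrow> x \<in> B \<longrightarrow> norm (Hb_apply (\<Phi> w) x) \<le> M"
  shows "\<exists>c. \<forall>w. (\<lambda>n. w ^ n *\<^sub>C c n) sums \<Phi> w"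
proof -
  obtain c where c: "\<And>n l x. unit_functional l \<Longrightarrow>
      l (Hb_apply (c n) x) = taylor_coeff (\<lambda>w. l (Hb_apply (\<Phi> w) x)) n"
    using Hb_taylor_coeff[of \<Phi>, OF hol bdd] by metis
  have "(\<lambda>n. w ^ n *\<^sub>C c n) sums \<Phi> w" for w
    unfolding sums_def tendsto_Hb_iff
  proof (intro allI impI uniform_limitI)
    fix B :: "'a set" and e :: real assume B: "bounded B" and e: "e > 0"
    \<comment> \<open>Ensures \<open>cmod w \<le> R / 2\<close>, keeps \<open>R\<close> positive at
      \<open>w = 0\<close>, and makes \<open>cmod w / R\<close> less than 1.\<close>
    define R where "R = 2 * (cmod w + 1)"
    have R: "R > 0" "cmod w \<le> R / 2" by (auto simp: R_def add_nonneg_pos)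
    obtain M where M: "\<And>w x. cmod w \<le> R \<Longrightarrow> x \<in> B \<Longrightarrow> norm (Hb_apply (\<Phi> w) x) \<le> M"
      using bdd[OF B] by blast
    have est: "norm (Hb_apply (\<Phi> w) x - Hb_apply (\<Sum>m<N. w ^ m *\<^sub>C c m) x)
        \<le> 2 * M * (cmod w / R) ^ N" if x: "x \<in> B" for x N
    proof (rule norm_leI_unit_functional)
      fix l assume l: "unit_functional (l :: 'b \<Rightarrow> complex)"
      have lin: "linear l" by (rule bounded_linear.linear[OF bounded_linear_unit_functional[OF l]])
      have "l (Hb_apply (\<Phi> w) x - Hb_apply (\<Sum>m<N. w ^ m *\<^sub>C c m) x) = l (Hb_apply (\<Phi> w) x)
          - (\<Sum>m<N. w ^ m * taylor_coeff (\<lambda>w. l (Hb_apply (\<Phi> w) x)) m)"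
        by (simp add: scaleC_Hb.rep_eq Hb_apply_sum unit_functional_scaleC[OF l]
            linear_diff[OF lin] linear_sum[OF lin] c[OF l])
      also have "cmod \<dots> \<le> 2 * M * (cmod w / R) ^ N"
        by (rule taylor_remainder[OF hol[OF l] R(1) _ R(2)])
          (rule order_trans[OF unit_functional_norm[OF l] M[OF _ x]])
      finally show "cmod (l (Hb_apply (\<Phi> w) x - Hb_apply (\<Sum>m<N. w ^ m *\<^sub>C c m) x))
          \<le> 2 * M * (cmod w / R) ^ N" .
    qed
    have "(\<lambda>N. 2 * M * (cmod w / R) ^ N) \<longlonglongrightarrow> 0"
      by (intro tendsto_mult_right_zero LIMSEQ_power_zero) (use R in \<open>auto simp: R_def\<close>)
    then have "\<forall>\<^sub>F N in sequentially. 2 * M * (cmod w / R) ^ N < e"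
      using e by (intro order_tendstoD(2)) auto
    then show "\<forall>\<^sub>F N in sequentially.
        \<forall>x\<in>B. dist (Hb_apply (\<Sum>m<N. w ^ m *\<^sub>C c m) x) (Hb_apply (\<Phi> w) x) < e"
      by eventually_elim (use est in \<open>auto simp: dist_norm norm_minus_commute intro: le_less_trans\<close>)
  qed
  then show ?thesis by blast
qed

section \<open>Continuity and holomorphy of composition\<close>

lemma Hb_compose_apply: "Hb_apply (Hb_compose f g) x = Hb_apply f (Hb_apply g x)"
  by (simp add: Hb_compose.rep_eq)

text \<open>The intermediate term is \<open>f0\<close> at the value of \<open>g i\<close>: uniform
  convergence of \<open>f\<close> on one ball handles the outer change,
  \<open>lipschitz_estimate\<close> the inner one. An arbitrary filter lets continuity on the
  product follow without sequences.\<close>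

lemma tendsto_Hb_compose:
  fixes f0 :: "('b::complex_normed_vector, 'c::complex_normed_vector) Hb"
    and g0 :: "('a::complex_normed_vector, 'b) Hb"
  assumes f: "(f \<longlongrightarrow> f0) F" and g: "(g \<longlongrightarrow> g0) F"
  shows "((\<lambda>i. Hb_compose (f i) (g i)) \<longlongrightarrow> Hb_compose f0 g0) F"
  unfolding tendsto_Hb_iff
proof (intro allI impI uniform_limitI)
  fix B :: "'a set" and e :: real assume B: "bounded B" and e: "e > 0"
  obtain K where K: "\<And>x. x \<in> B \<Longrightarrow> norm (Hb_apply g0 x) \<le> K"
    using Hb_bounded_image[OF B, of g0] by (auto simp: bounded_iff)
  \<comment> \<open>The margin 1 lets one ball hold both the nearby values of \<open>g i\<close> and
    the unit balls around \<open>Hb_apply g0 x\<close> that \<open>lipschitz_estimate\<close>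
    requires.\<close>
  have near: "y \<in> cball 0 (K + 1)" if "x \<in> B" "norm (y - Hb_apply g0 x) \<le> 1" for x y
    using K[OF that(1)] that(2) norm_triangle_ineq2[of y "Hb_apply g0 x"] by simp
  obtain M where M: "M > 0" "\<And>y. y \<in> cball 0 (K + 1) \<Longrightarrow> norm (Hb_apply f0 y) \<le> M"
    using Hb_bounded_image[OF bounded_cball, of f0 0 "K + 1"] by (auto simp: bounded_pos)
  \<comment> \<open>\<open>1 / 2\<close> is the range of \<open>lipschitz_estimate\<close>;
    \<open>e / (4 * M)\<close> compensates its constant \<open>2 * M\<close> up to
    \<open>e / 2\<close>.\<close>
  define d where "d = min (1 / 2) (e / (4 * M))"
  have d: "d > 0" "d \<le> 1 / 2" "2 * M * d \<le> e / 2"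
    using e M(1) by (auto simp: d_def min_def field_simps)
  have "\<forall>\<^sub>F i in F. \<forall>y\<in>cball 0 (K + 1). dist (Hb_apply (f i) y) (Hb_apply f0 y) < e / 2"
    using f[unfolded tendsto_Hb_iff] e by (intro uniform_limitD) auto
  moreover have "\<forall>\<^sub>F i in F. \<forall>x\<in>B. dist (Hb_apply (g i) x) (Hb_apply g0 x) < d"
    using g[unfolded tendsto_Hb_iff] B d by (intro uniform_limitD) auto
  ultimately show "\<forall>\<^sub>F i in F. \<forall>x\<in>B.
      dist (Hb_apply (Hb_compose (f i) (g i)) x) (Hb_apply (Hb_compose f0 g0) x) < e"
  proof eventually_elim
    case (elim i)
    show ?case
    proof
      fix x assume x: "x \<in> B"
      let ?y = "Hb_apply (g i) x" and ?z = "Hb_apply g0 x"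
      have yd: "norm (?y - ?z) < d" using elim(2) x by (simp add: dist_norm)
      have "norm (Hb_apply f0 ?y - Hb_apply f0 ?z) \<le> 2 * M * norm (?y - ?z)"
        by (rule lipschitz_estimate)
          (use Hb_differentiable M(2) near[OF x] yd d(2) in auto)
      also have "\<dots> \<le> 2 * M * d" using less_imp_le[OF yd] M(1) by (intro mult_left_mono) auto
      also have "\<dots> \<le> e / 2" by (rule d(3))
      finally have "dist (Hb_apply f0 ?y) (Hb_apply f0 ?z) \<le> e / 2" by (simp add: dist_norm)
      moreover have "dist (Hb_apply (f i) ?y) (Hb_apply f0 ?y) < e / 2"
        using elim(1) near[OF x, of ?y] yd d(2) by auto
      ultimately show "dist (Hb_apply (Hb_compose (f i) (g i)) x) (Hb_apply (Hb_compose f0 g0) x) < e"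
        using dist_triangle[of "Hb_apply (f i) ?y" "Hb_apply f0 ?z" "Hb_apply f0 ?y"]
        by (simp add: Hb_compose_apply)
    qed
  qed
qed

lemma Hb_bound_on_bounded:
  assumes "bounded B"
  obtains M where "M \<ge> 0" "\<And>x. x \<in> B \<Longrightarrow> norm (Hb_apply f x) \<le> M"
proof -
  from Hb_bounded_image[OF assms, of f] obtain M where "M > 0" "\<And>x. x \<in> B \<Longrightarrow> norm (Hb_apply f x) \<le> M"
    by (auto simp: bounded_pos)
  then show ?thesis by (intro that[of M]) auto
qed

text \<open>At a fixed point the curve is \<open>f\<close> plus \<open>w\<close> times
  \<open>h\<close>, both evaluated along one complex line, so \<open>holomorphic_line\<close> gives
  weak holomorphy. For bounded \<open>w\<close> and \<open>x\<close> in \<open>B\<close> these lines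
  stay in a fixed ball, on which \<open>f\<close> and \<open>h\<close> are bounded.\<close>

lemma compose_line_power_series:
  fixes f h :: "('b::complex_normed_vector, 'c::complex_banach) Hb"
    and g k :: "('a::complex_normed_vector, 'b) Hb"
  shows "\<exists>c. \<forall>w. (\<lambda>n. w ^ n *\<^sub>C c n) sums Hb_compose (f + w *\<^sub>C h) (g + w *\<^sub>C k)"
proof (rule Hb_power_series)
  have comp: "Hb_apply (Hb_compose (f + w *\<^sub>C h) (g + w *\<^sub>C k)) x
      = Hb_apply f (Hb_apply g x + w *\<^sub>C Hb_apply k x)
        + w *\<^sub>C Hb_apply h (Hb_apply g x + w *\<^sub>C Hb_apply k x)" for w x
    by (simp add: Hb_compose_apply plus_Hb.rep_eq scaleC_Hb.rep_eq)
  show "(\<lambda>w. l (Hb_apply (Hb_compose (f + w *\<^sub>C h) (g + w *\<^sub>C k)) x)) holomorphic_on UNIV"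
    if l: "unit_functional l" for l x
    unfolding comp unit_functional_add[OF l] unit_functional_scaleC[OF l]
    by (intro holomorphic_on_add holomorphic_on_mult holomorphic_on_ident
        holomorphic_line Hb_differentiable l)
  fix B :: "'a set" and R :: real assume B: "bounded B"
  obtain G where G: "G \<ge> 0" "\<And>x. x \<in> B \<Longrightarrow> norm (Hb_apply g x) \<le> G"
    using Hb_bound_on_bounded[OF B] by metis
  obtain K where K: "K \<ge> 0" "\<And>x. x \<in> B \<Longrightarrow> norm (Hb_apply k x) \<le> K"
    using Hb_bound_on_bounded[OF B] by metis
  let ?C = "cball (0 :: 'b) (G + \<bar>R\<bar> * K)"
  obtain M where M: "M \<ge> 0" "\<And>y. y \<in> ?C \<Longrightarrow> norm (Hb_apply f y) \<le> M"
    using Hb_bound_on_bounded[OF bounded_cball] by metis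
  obtain H where H: "H \<ge> 0" "\<And>y. y \<in> ?C \<Longrightarrow> norm (Hb_apply h y) \<le> H"
    using Hb_bound_on_bounded[OF bounded_cball] by metis
  have "norm (Hb_apply (Hb_compose (f + w *\<^sub>C h) (g + w *\<^sub>C k)) x) \<le> M + \<bar>R\<bar> * H"
    if w: "cmod w \<le> R" and x: "x \<in> B" for w x
  proof -
    let ?y = "Hb_apply g x + w *\<^sub>C Hb_apply k x"
    have "norm ?y \<le> G + \<bar>R\<bar> * K"
      by (rule norm_triangle_le, rule add_mono)
        (use G(2)[OF x] K(2)[OF x] w in \<open>auto simp: norm_scaleC intro!: mult_mono\<close>)
    then have y: "?y \<in> ?C" by simp
    show ?thesis
      unfolding comp
      by (rule norm_triangle_le, rule add_mono)
        (use M(2)[OF y] H(2)[OF y] w in \<open>auto simp: norm_scaleC intro!: mult_mono\<close>)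
  qed
  then show "\<exists>M. \<forall>w x. cmod w \<le> R \<longrightarrow> x \<in> B \<longrightarrow>
      norm (Hb_apply (Hb_compose (f + w *\<^sub>C h) (g + w *\<^sub>C k)) x) \<le> M"
    by blast
qed

theorem theorem2p6:
  shows "frechet_holomorphic
    (\<lambda>(f :: ('e::complex_banach, 'e) Hb, g :: ('e, 'e) Hb). Hb_compose f g)"
  unfolding frechet_holomorphic_def
proof
  show "continuous_on UNIV (\<lambda>(f :: ('e, 'e) Hb, g :: ('e, 'e) Hb). Hb_compose f g)"
    unfolding continuous_on_def case_prod_beta
    by (intro ballI tendsto_Hb_compose tendsto_fst tendsto_snd tendsto_ident_at)
next
  show "G_holomorphic (\<lambda>(f :: ('e, 'e) Hb, g :: ('e, 'e) Hb). Hb_compose f g)"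
    unfolding G_holomorphic_def entire_analytic_def
  proof (intro allI)
    fix a b :: "('e, 'e) Hb \<times> ('e, 'e) Hb" and z0 :: complex
    obtain f g h k where ab: "a = (f, g)" "b = (h, k)" by (cases a, cases b)
    \<comment> \<open>Expanding about \<open>z0\<close> is expanding about 0 after moving the base
      point to \<open>(f + z0 *\<^sub>C h, g + z0 *\<^sub>C k)\<close>.\<close>
    obtain c where c: "\<forall>w. (\<lambda>n. w ^ n *\<^sub>C c n) sums
        Hb_compose ((f + z0 *\<^sub>C h) + w *\<^sub>C h) ((g + z0 *\<^sub>C k) + w *\<^sub>C k)"
      using compose_line_power_series by blast
    have eq: "(f + z0 *\<^sub>C h) + (z - z0) *\<^sub>C h = f + z *\<^sub>C h" for f h :: "('e, 'e) Hb" and z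
      by (simp add: add.assoc scaleC_add_left[symmetric])
    have "(\<lambda>n. (z - z0) ^ n *\<^sub>C c n) sums (case a + z *\<^sub>C b of (f, g) \<Rightarrow> Hb_compose f g)" for z
      using c[rule_format, of "z - z0"]
      by (simp only: eq ab scaleC_prod_def fst_conv snd_conv add_Pair prod.case)
    \<comment> \<open>The series converges for every \<open>z\<close>, so the radius 1 is an
      arbitrary choice.\<close>
    then show "\<exists>r>0. \<exists>c. \<forall>z. cmod (z - z0) < r \<longrightarrow>
        (\<lambda>n. (z - z0) ^ n *\<^sub>C c n) sums (case a + z *\<^sub>C b of (f, g) \<Rightarrow> Hb_compose f g)"
      using zero_less_one by blast
  qed
qed

end
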